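(* Let $M\in\mathbb{R}^{2n\times 2n}$ be symmetric positive-definite and let $1\le k\le n$. The set of all critical points of the problem $\min_{X\in\mathbb{R}^{2n\times 2k}} \mathrm{tr}(X^TMX)$ subject to $X^TJ_{2n}X=J_{2k}$ is the union of all sets $X\,\mathrm{OrSp}(2k)=\{XK: K\in\mathrm{OrSp}(2k)\}$, where $X$ ranges over all matrices in $\mathrm{Sp}(2k,2n)$ whose columns form a normalized symplectic eigenvector set of $M$.
   Context: Let $J_{2n}=\begin{bmatrix}0&I_n\\-I_n&0\end{bmatrix}$. $\mathrm{Sp}(2k,2n)=\{X\in\mathbb{R}^{2n\times 2k}: X^TJ_{2n}X=J_{2k}\}$, $\mathrm{Sp}(2k)=\mathrm{Sp}(2k,2k)$, and $\mathrm{OrSp}(2k)$ is the set of matrices in $\mathrm{Sp}(2k)$ that are also orthogonal. Critical point: $X_*\in\mathbb{R}^{2n\times 2k}$ is a critical point of the problem if $X_*^TJ_{2n}X_*=J_{2k}$ and there is a skew-symmetric Lagrange multiplier $L_*\in\mathbb{R}^{2k\times 2k}$ with $MX_*=J_{2n}X_*L_*$. Symplectic eigenvalues: by Williamson's theorem there is $S\in\mathrm{Sp}(2n)$ with $S^TMS=\mathrm{diag}(D,D)$, $D=\mathrm{diag}(d_1,\dots,d_n)$, $0<d_1\le\dots\le d_n$; the $d_i$ (uniquely determined by $M$) are the symplectic eigenvalues of $M$. Normalized symplectic eigenvector set: the columns of $X\in\mathbb{R}^{2n\times 2k}$ form a normalized symplectic eigenvector set of $M$ associated with the symplectic eigenvalues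 $\lambda_1,\dots,\lambda_k$ if $X\in\mathrm{Sp}(2k,2n)$ and $MX=J_{2n}X\begin{bmatrix}0&-\Lambda\\\Lambda&0\end{bmatrix}$ with $\Lambda=\mathrm{diag}(\lambda_1,\dots,\lambda_k)$; they form a normalized symplectic eigenvector set of $M$ if this holds for some symplectic eigenvalues $\lambda_1,\dots,\lambda_k$ of $M$. *)

theory Defs
  imports Complex_Main "Jordan_Normal_Form.Matrix"
begin

text \<open>
  The dimension arguments of the constants below are half-dimensions: \<open>J_mat n\<close> is the
  \<open>2n \<times> 2n\<close> matrix \<open>J\<^sub>2\<^sub>n\<close>, and \<open>Sp k n\<close> is the set \<open>Sp(2k,2n)\<close> of \<open>2n \<times> 2k\<close> matrices.
  Rows, columns and families of eigenvalues are indexed from 0.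
\<close>

definition J_mat :: "nat \<Rightarrow> real mat" where
  "J_mat n = four_block_mat (0\<^sub>m n n) (1\<^sub>m n) (- 1\<^sub>m n) (0\<^sub>m n n)"

definition Sp :: "nat \<Rightarrow> nat \<Rightarrow> real mat set" where
  "Sp k n = {X \<in> carrier_mat (2 * n) (2 * k). transpose_mat X * J_mat n * X = J_mat k}"

text \<open>
  The predicate \<^const>\<open>orthogonal_mat\<close> of the library only asks for mutually orthogonal nonzero
  columns, without normalization, so orthogonality is written out.
\<close>

definition OrSp :: "nat \<Rightarrow> real mat set" where
  "OrSp k = {K \<in> Sp k k. transpose_mat K * K = 1\<^sub>m (2 * k)}"

definition sym_pos_def :: "nat \<Rightarrow> real mat \<Rightarrow> bool" where
  "sym_pos_def m M \<longleftrightarrow>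
     M \<in> carrier_mat m m \<and> transpose_mat M = M \<and>
     (\<forall>v \<in> carrier_vec m. v \<noteq> 0\<^sub>v m \<longrightarrow> v \<bullet> (M *\<^sub>v v) > 0)"

text \<open>
  A critical point of the minimization of the trace of \<open>X\<^sup>T M X\<close> over \<open>Sp(2k,2n)\<close>: a feasible
  point for which a skew-symmetric Lagrange multiplier exists. The objective enters through half
  its gradient, which is \<open>M X\<close> for symmetric \<open>M\<close>.
\<close>

definition critical_point :: "nat \<Rightarrow> nat \<Rightarrow> real mat \<Rightarrow> real mat \<Rightarrow> bool" where
  "critical_point n k M X \<longleftrightarrow>
     X \<in> carrier_mat (2 * n) (2 * k) \<and>
     transpose_mat X * J_mat n * X = J_mat k \<and>
     (\<exists>L \<in> carrier_mat (2 * k) (2 * k). transpose_mat L = - L \<and> M * X = J_mat n * X * L)"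

text \<open>
  \<open>d 0 \<le> \<dots> \<le> d (n - 1)\<close> are the diagonal entries of a Williamson normal form of \<open>M\<close>. They are
  determined by \<open>M\<close>, so quantifying existentially over \<open>S\<close> and \<open>d\<close> in
  \<open>symplectic_eigenvalue\<close> involves no choice.
\<close>

definition symplectic_spectrum :: "nat \<Rightarrow> real mat \<Rightarrow> (nat \<Rightarrow> real) \<Rightarrow> bool" where
  "symplectic_spectrum n M d \<longleftrightarrow>
     (\<forall>i<n. 0 < d i) \<and> (\<forall>i j. i \<le> j \<longrightarrow> j < n \<longrightarrow> d i \<le> d j) \<and>
     (\<exists>S \<in> Sp n n. transpose_mat S * M * S =
        four_block_mat (mat_diag n d) (0\<^sub>m n n) (0\<^sub>m n n) (mat_diag n d))"

definition symplectic_eigenvalue :: "nat \<Rightarrow> real mat \<Rightarrow> real \<Rightarrow> bool" where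
  "symplectic_eigenvalue n M l \<longleftrightarrow> (\<exists>d. symplectic_spectrum n M d \<and> (\<exists>i<n. l = d i))"

text \<open>
  The family \<open>l 0, \<dots>, l (k - 1)\<close> may be in any order and may repeat values. No
  multiplicity bound is imposed: since \<open>X\<close> has full column rank, the equation for \<open>M X\<close> already
  prevents a value from occurring more often than in the symplectic spectrum.
\<close>

definition normalized_symplectic_eigenvector_set_for ::
    "nat \<Rightarrow> nat \<Rightarrow> real mat \<Rightarrow> (nat \<Rightarrow> real) \<Rightarrow> real mat \<Rightarrow> bool" where
  "normalized_symplectic_eigenvector_set_for n k M l X \<longleftrightarrow>
     (\<forall>i<k. symplectic_eigenvalue n M (l i)) \<and> X \<in> Sp k n \<and>
     M * X = J_mat n * X *
       four_block_mat (0\<^sub>m k k) (- mat_diag k l) (mat_diag k l) (0\<^sub>m k k)"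

definition normalized_symplectic_eigenvector_set ::
    "nat \<Rightarrow> nat \<Rightarrow> real mat \<Rightarrow> real mat \<Rightarrow> bool" where
  "normalized_symplectic_eigenvector_set n k M X \<longleftrightarrow>
     (\<exists>l. normalized_symplectic_eigenvector_set_for n k M l X)"

end

theory Submission
  imports Defs "Jordan_Normal_Form.Determinant" "HOL-Computational_Algebra.Fundamental_Theorem_Algebra"
begin

text \<open>
  If \<open>X\<close> is critical with multiplier \<open>L\<close>, then \<open>A = X\<^sup>T M X = J L\<close> is symmetric
  positive definite, and skew-symmetry of \<open>L\<close> makes it commute with \<open>J\<close>. For such \<open>A\<close> the
  matrix \<open>S\<close> of a Williamson normal form is automatically orthogonal: its columns \<open>u, v\<close>
  satisfy \<open>A u = d J v\<close> and \<open>A v = - d J u\<close>, hence \<open>A\<^sup>2 u = d\<^sup>2 u\<close>, so that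
  \<open>A u = d u\<close> and \<open>u = J v\<close>. Therefore \<open>X = (X S) S\<^sup>T\<close>, where \<open>X S\<close> is a normalized
  symplectic eigenvector set.

  Williamson's theorem is obtained by adding one pair \<open>u, v\<close> at a time. The map \<open>J M\<close> is
  skew-adjoint for the inner product \<open>x\<^sup>T M y\<close> and preserves the symplectic complement of the
  pairs found so far; real and imaginary part of a complex eigenvector in that complement, which
  exists by the usual Krylov argument, give the next pair.
\<close>

section \<open>Kernels of wide matrices and eigenvectors in invariant subspaces\<close>

text \<open>Padding \<open>A\<close> with zero rows gives a square matrix \<open>B\<close> whose row
  \<open>r\<close> vanishes. Laplace expansion along that row gives determinant zero, and a kernel
  vector of \<open>B\<close> is one of \<open>A\<close>.\<close>

lemma wide_mat_kernel:
  fixes A :: "'a :: field mat"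
  assumes A: "A \<in> carrier_mat r c" and "r < c"
  obtains v where "v \<in> carrier_vec c" "v \<noteq> 0\<^sub>v c" "A *\<^sub>v v = 0\<^sub>v r"
proof -
  define B where "B = mat c c (\<lambda>(i, j). if i < r then A $$ (i, j) else 0)"
  have B: "B \<in> carrier_mat c c" by (simp add: B_def)
  have "det B = (\<Sum>j<c. B $$ (r, j) * cofactor B r j)"
    by (rule laplace_expansion_row[OF B \<open>r < c\<close>])
  also have "\<dots> = 0" using \<open>r < c\<close> by (intro sum.neutral) (auto simp: B_def)
  finally obtain v where v: "v \<in> carrier_vec c" "v \<noteq> 0\<^sub>v c" "B *\<^sub>v v = 0\<^sub>v c"
    using det_0_iff_vec_prod_zero_field[OF B] by auto
  have "A *\<^sub>v v = 0\<^sub>v r"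
  proof (intro eq_vecI)
    fix i assume "i < dim_vec (0\<^sub>v r :: 'a vec)"
    then have i: "i < r" by simp
    then have "row A i = row B i" using A \<open>r < c\<close> by (intro eq_vecI) (auto simp: B_def)
    then have "(A *\<^sub>v v) $ i = (B *\<^sub>v v) $ i" using i A B \<open>r < c\<close> by auto
    then show "(A *\<^sub>v v) $ i = 0\<^sub>v r $ i" using v i \<open>r < c\<close> by simp
  qed (use A in auto)
  with v that show thesis by blast
qed

text \<open>The length \<open>n\<close> is an argument because the empty sum has to be the zero
  vector of a definite length.\<close>

primrec lincomb_upto :: "nat \<Rightarrow> (nat \<Rightarrow> 'a :: field) \<Rightarrow> (nat \<Rightarrow> 'a vec) \<Rightarrow> nat \<Rightarrow> 'a vec" where
  "lincomb_upto n c x 0 = 0\<^sub>v n"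
| "lincomb_upto n c x (Suc m) = lincomb_upto n c x m + c m \<cdot>\<^sub>v x m"

lemma lincomb_upto_carrier [simp]:
  "(\<And>j. x j \<in> carrier_vec n) \<Longrightarrow> lincomb_upto n c x m \<in> carrier_vec n"
  by (induction m) auto

lemma lincomb_upto_index:
  "(\<And>j. x j \<in> carrier_vec n) \<Longrightarrow> i < n \<Longrightarrow> lincomb_upto n c x m $ i = (\<Sum>j<m. c j * x j $ i)"
proof (induction m)
  case (Suc m)
  then have "i < dim_vec (x m)" by (metis carrier_vecD)
  with Suc show ?case by simp
qed simp

lemma mult_mat_lincomb_upto:
  fixes A :: "'a :: field mat"
  assumes A: "A \<in> carrier_mat n n" and x: "\<And>j. x j \<in> carrier_vec n"
  shows "A *\<^sub>v lincomb_upto n c x m = lincomb_upto n c (\<lambda>j. A *\<^sub>v x j) m"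
  using assms
  by (induction m) (auto simp: mult_add_distrib_mat_vec[of A n n] mult_mat_vec[of A n n])

text \<open>Take a nonzero polynomial \<open>p\<close> of least degree with p(A) w = 0 and split off
  a root: p = (t - \<mu>) q. By minimality q(A) w is nonzero, and A - \<mu> kills it. Everything
  happens among the iterates of \<open>w\<close>, so \<open>W\<close> needs no basis.\<close>

lemma eigenvector_in_invariant_subspace:
  fixes A :: "complex mat"
  assumes A: "A \<in> carrier_mat n n" and W: "W \<subseteq> carrier_vec n"
    and zero: "0\<^sub>v n \<in> W"
    and add: "\<And>x y. x \<in> W \<Longrightarrow> y \<in> W \<Longrightarrow> x + y \<in> W"
    and smult: "\<And>c x. x \<in> W \<Longrightarrow> c \<cdot>\<^sub>v x \<in> W"
    and inv: "\<And>x. x \<in> W \<Longrightarrow> A *\<^sub>v x \<in> W"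
    and w: "w \<in> W" "w \<noteq> 0\<^sub>v n"
  obtains z \<mu> where "z \<in> W" "z \<noteq> 0\<^sub>v n" "A *\<^sub>v z = \<mu> \<cdot>\<^sub>v z"
proof -
  define x where "x j = ((*\<^sub>v) A ^^ j) w" for j
  have xW: "x j \<in> W" for j by (induction j) (auto simp: x_def w inv)
  then have xc: "x j \<in> carrier_vec n" for j using W by blast
  have xS: "A *\<^sub>v x j = x (Suc j)" for j by (simp add: x_def)
  \<comment> \<open>For \<open>m > degree p\<close> the vector \<open>E p m\<close> is p(A) w. The
    bound \<open>m\<close> stays an argument, and \<open>ann\<close> asks for some admissible bound
    only, which avoids comparing sums of different lengths.\<close>
  define E where "E p m = lincomb_upto n (coeff p) x m" for p m
  have EW: "E p m \<in> W" for p m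
    unfolding E_def by (induction m) (auto simp: zero add smult xW)
  have Ec: "E p m \<in> carrier_vec n" for p m using EW W by blast
  define ann where "ann p \<longleftrightarrow> p \<noteq> 0 \<and> (\<exists>m>degree p. E p m = 0\<^sub>v n)" for p
  have "\<exists>p. ann p"
  proof -
    \<comment> \<open>The \<open>n + 1\<close> iterates \<open>x 0\<close>, ..., \<open>x n\<close>
      lie in dimension \<open>n\<close>, so they are linearly dependent. The coefficients of a
      dependence are those of an annihilating polynomial.\<close>
    have "mat_of_cols n (map x [0..<Suc n]) \<in> carrier_mat n (Suc n)"
      by (metis length_map length_upt diff_zero mat_of_cols_carrier(1))
    then obtain c where c: "c \<in> carrier_vec (Suc n)" "c \<noteq> 0\<^sub>v (Suc n)"
      "mat_of_cols n (map x [0..<Suc n]) *\<^sub>v c = 0\<^sub>v n"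
      using wide_mat_kernel[of _ n "Suc n"] by blast
    define p where "p = Poly (list_of_vec c)"
    have cp: "coeff p j = (if j < Suc n then c $ j else 0)" for j
      using c(1) by (auto simp: p_def nth_default_def list_of_vec_index)
    have "degree p < Suc n" using cp by (metis degree_le le_simps(2) less_Suc_eq_le not_less)
    moreover have "p \<noteq> 0"
    proof
      assume "p = 0"
      then have "c $ j = 0" if "j < Suc n" for j using cp[of j] that by simp
      then have "c = 0\<^sub>v (Suc n)" using c(1) by (intro eq_vecI) auto
      with c(2) show False by simp
    qed
    moreover have "E p (Suc n) = 0\<^sub>v n"
    proof (intro eq_vecI)
      fix i assume "i < dim_vec (0\<^sub>v n :: complex vec)"
      then have i: "i < n" by simp
      have "E p (Suc n) $ i = (\<Sum>j<Suc n. c $ j * x j $ i)"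
        unfolding E_def lincomb_upto_index[OF xc i] by (intro sum.cong) (auto simp: cp)
      also have "\<dots> = (mat_of_cols n (map x [0..<Suc n]) *\<^sub>v c) $ i"
        using i c(1) xc
        by (auto simp: scalar_prod_def mat_of_cols_index mult.commute lessThan_atLeast0
            simp del: upt_Suc sum.op_ivl_Suc intro!: sum.cong)
      finally show "E p (Suc n) $ i = 0\<^sub>v n $ i" using c(3) by simp
    qed (use Ec[of p "Suc n"] in auto)
    ultimately show ?thesis unfolding ann_def by blast
  qed
  then obtain p where p: "ann p" and least: "\<And>q. ann q \<Longrightarrow> degree p \<le> degree q"
    using ex_has_least_nat[of ann _ degree] by blast
  obtain m where m: "m > degree p" "E p m = 0\<^sub>v n" and "p \<noteq> 0" using p ann_def by blast
  \<comment> \<open>A nonzero constant cannot annihilate \<open>w\<close>, so the fundamental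
    theorem of algebra supplies a root of \<open>p\<close>.\<close>
  have "degree p \<noteq> 0"
  proof
    assume "degree p = 0"
    then obtain a where a: "p = [:a:]" by (meson degree_eq_zeroE)
    have "E [:a:] (Suc j) = a \<cdot>\<^sub>v w" for j
    proof (induction j)
      case 0
      have "x 0 = w" by (simp add: x_def)
      then show ?case using xc[of 0] by (simp add: E_def)
    next
      case (Suc j)
      have "0 \<cdot>\<^sub>v x (Suc j) = 0\<^sub>v n" using xc[of "Suc j"] by auto
      moreover have "w \<in> carrier_vec n" using w(1) W by blast
      ultimately show ?case using Suc by (simp add: E_def)
    qed
    from this[of "m - 1"] have "a \<cdot>\<^sub>v w = 0\<^sub>v n" using m a by simp
    moreover have "a \<noteq> 0" using \<open>p \<noteq> 0\<close> a by simp
    moreover have "inverse a \<cdot>\<^sub>v 0\<^sub>v n = (0\<^sub>v n :: complex vec)" by auto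
    ultimately have "(inverse a * a) \<cdot>\<^sub>v w = 0\<^sub>v n"
      by (metis smult_smult_assoc)
    with \<open>a \<noteq> 0\<close> w show False by simp
  qed
  then obtain \<mu> where "poly p \<mu> = 0"
    using fundamental_theorem_of_algebra[of p] by (auto simp: constant_degree)
  then obtain q where q: "p = [:-\<mu>, 1:] * q" by (auto simp: poly_eq_0_iff_dvd dvd_def)
  then have "q \<noteq> 0" using \<open>p \<noteq> 0\<close> by auto
  then have deg: "degree p = Suc (degree q)" unfolding q by (subst degree_mult_eq) auto
  \<comment> \<open>Dividing by a linear factor lowers the degree by one, and the summation bound is
    lowered along with it.\<close>
  obtain m' where m': "m = Suc m'" "m' > degree q" using m(1) deg by (cases m) auto
  have nz: "E q m' \<noteq> 0\<^sub>v n"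
    using least[of q] deg \<open>q \<noteq> 0\<close> m' unfolding ann_def by auto
  have "A *\<^sub>v E q m' = \<mu> \<cdot>\<^sub>v E q m'"
  proof (intro eq_vecI)
    fix i assume "i < dim_vec (\<mu> \<cdot>\<^sub>v E q m')"
    then have i: "i < n" using Ec[of q m'] by auto
    have Eq: "E q m' $ i = (\<Sum>j<m'. coeff q j * x j $ i)"
      unfolding E_def by (rule lincomb_upto_index[OF xc i])
    have "A *\<^sub>v E q m' = lincomb_upto n (coeff q) (\<lambda>j. x (Suc j)) m'"
      unfolding E_def mult_mat_lincomb_upto[OF A xc] xS ..
    then have AEq: "(A *\<^sub>v E q m') $ i = (\<Sum>j<m'. coeff q j * x (Suc j) $ i)"
      using lincomb_upto_index[of "\<lambda>j. x (Suc j)", OF xc i] by simp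
    \<comment> \<open>The coefficients of \<open>p\<close> are those of \<open>q\<close> shifted by
      one minus \<mu> times those of \<open>q\<close>. The shift becomes an application of
      \<open>A\<close>, so \<open>E p m = 0\<close> reads as the eigenvector equation once the top
      term has been dropped: \<open>coeff q m'\<close> is zero because
      \<open>m' > degree q\<close>.\<close>
    have cp: "coeff p j = coeff (pCons 0 q) j - \<mu> * coeff q j" for j
      unfolding q by simp
    have "0 = E p m $ i" using m(2) i by simp
    also have "\<dots> = (\<Sum>j<Suc m'. coeff p j * x j $ i)"
      unfolding E_def m' by (rule lincomb_upto_index[OF xc i])
    also have "\<dots> = (\<Sum>j<Suc m'. coeff (pCons 0 q) j * x j $ i) - \<mu> * (\<Sum>j<Suc m'. coeff q j * x j $ i)"
      unfolding cp by (simp add: algebra_simps sum_subtractf sum_distrib_left del: sum.lessThan_Suc)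
    also have "(\<Sum>j<Suc m'. coeff (pCons 0 q) j * x j $ i) = (\<Sum>j<m'. coeff q j * x (Suc j) $ i)"
      by (subst sum.lessThan_Suc_shift) simp
    also have "(\<Sum>j<Suc m'. coeff q j * x j $ i) = (\<Sum>j<m'. coeff q j * x j $ i)"
      using m'(2) by (simp add: coeff_eq_0)
    finally show "(A *\<^sub>v E q m') $ i = (\<mu> \<cdot>\<^sub>v E q m') $ i"
      using AEq Eq i Ec[of q m'] by simp
  qed (use A Ec[of q m'] in auto)
  with nz EW that show thesis by blast
qed

text \<open>A complex eigenvector z = a + i b of \<open>A\<close> with eigenvalue \<alpha> + i
  \<beta> is split into real and imaginary parts. The vectors \<open>a\<close> and \<open>b\<close>
  may be linearly dependent; only their vanishing together is excluded.\<close>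

lemma real_invariant_plane:
  fixes A :: "real mat"
  assumes A: "A \<in> carrier_mat n n" and W: "W \<subseteq> carrier_vec n"
    and zero: "0\<^sub>v n \<in> W"
    and add: "\<And>x y. x \<in> W \<Longrightarrow> y \<in> W \<Longrightarrow> x + y \<in> W"
    and smult: "\<And>c x. x \<in> W \<Longrightarrow> c \<cdot>\<^sub>v x \<in> W"
    and inv: "\<And>x. x \<in> W \<Longrightarrow> A *\<^sub>v x \<in> W"
    and w: "w \<in> W" "w \<noteq> 0\<^sub>v n"
  obtains a b \<alpha> \<beta> where "a \<in> W" "b \<in> W" "a \<noteq> 0\<^sub>v n \<or> b \<noteq> 0\<^sub>v n"
    "A *\<^sub>v a = \<alpha> \<cdot>\<^sub>v a + (- \<beta>) \<cdot>\<^sub>v b" "A *\<^sub>v b = \<beta> \<cdot>\<^sub>v a + \<alpha> \<cdot>\<^sub>v b"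
proof -
  interpret of_real: semiring_hom complex_of_real by unfold_locales auto
  let ?A = "map_mat complex_of_real A"
  define V where "V = {z \<in> carrier_vec n. map_vec Re z \<in> W \<and> map_vec Im z \<in> W}"
  have A': "?A \<in> carrier_mat n n" using A by simp
  have Re_A: "map_vec Re (?A *\<^sub>v z) = A *\<^sub>v map_vec Re z"
    and Im_A: "map_vec Im (?A *\<^sub>v z) = A *\<^sub>v map_vec Im z" if "z \<in> carrier_vec n" for z
    using A that by (auto intro!: eq_vecI sum.cong simp: scalar_prod_def)
  have "\<exists>z \<mu>. z \<in> V \<and> z \<noteq> 0\<^sub>v n \<and> ?A *\<^sub>v z = \<mu> \<cdot>\<^sub>v z"
  proof (rule eigenvector_in_invariant_subspace[OF A', of V "map_vec complex_of_real w"])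
    show "V \<subseteq> carrier_vec n" by (auto simp: V_def)
    have "map_vec Re (0\<^sub>v n) = 0\<^sub>v n" "map_vec Im (0\<^sub>v n) = 0\<^sub>v n" by auto
    then show "0\<^sub>v n \<in> V" using zero by (simp add: V_def)
    show "x + y \<in> V" if "x \<in> V" "y \<in> V" for x y
    proof -
      have "map_vec Re (x + y) = map_vec Re x + map_vec Re y"
        "map_vec Im (x + y) = map_vec Im x + map_vec Im y"
        using that by (auto simp: V_def)
      then show ?thesis using that add by (auto simp: V_def)
    qed
    \<comment> \<open>Complex multiples mix the two parts with real coefficients, so closure of
      \<open>W\<close> under real combinations suffices.\<close>
    show "c \<cdot>\<^sub>v x \<in> V" if "x \<in> V" for c x
    proof -
      have "map_vec Re (c \<cdot>\<^sub>v x) = Re c \<cdot>\<^sub>v map_vec Re x + (- Im c) \<cdot>\<^sub>v map_vec Im x"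
        "map_vec Im (c \<cdot>\<^sub>v x) = Im c \<cdot>\<^sub>v map_vec Re x + Re c \<cdot>\<^sub>v map_vec Im x"
        using that by (auto simp: V_def)
      then show ?thesis using that add smult by (auto simp: V_def)
    qed
    show "?A *\<^sub>v x \<in> V" if "x \<in> V" for x
      using that A' Re_A[of x] Im_A[of x] inv by (auto simp: V_def)
    have "map_vec Re (map_vec complex_of_real w) = w"
      "map_vec Im (map_vec complex_of_real w) = 0\<^sub>v n"
      using w W by (auto intro!: eq_vecI)
    then show "map_vec complex_of_real w \<in> V" using w W zero by (auto simp: V_def)
    show "map_vec complex_of_real w \<noteq> 0\<^sub>v n"
    proof
      assume "map_vec complex_of_real w = 0\<^sub>v n"
      then have "w = map_vec Re (0\<^sub>v n)"
        using \<open>map_vec Re (map_vec complex_of_real w) = w\<close> by metis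
      then show False using w by auto
    qed
  qed blast
  then obtain z \<mu> where z: "z \<in> V" "z \<noteq> 0\<^sub>v n" "?A *\<^sub>v z = \<mu> \<cdot>\<^sub>v z" by blast
  have zc: "z \<in> carrier_vec n" using z by (simp add: V_def)
  show thesis
  proof (rule that)
    show "map_vec Re z \<in> W" "map_vec Im z \<in> W" using z by (auto simp: V_def)
    show "map_vec Re z \<noteq> 0\<^sub>v n \<or> map_vec Im z \<noteq> 0\<^sub>v n"
    proof (rule ccontr)
      assume H: "\<not> ?thesis"
      have "z $ i = 0" if "i < n" for i
      proof -
        have "map_vec Re z $ i = 0" "map_vec Im z $ i = 0" using H that by auto
        then show ?thesis using zc that by (auto simp: complex_eq_iff)
      qed
      then have "z = 0\<^sub>v n" using zc by (auto intro!: eq_vecI)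
      with z show False by simp
    qed
    show "A *\<^sub>v map_vec Re z = Re \<mu> \<cdot>\<^sub>v map_vec Re z + (- Im \<mu>) \<cdot>\<^sub>v map_vec Im z"
      unfolding Re_A[OF zc, symmetric] z(3) by auto
    show "A *\<^sub>v map_vec Im z = Im \<mu> \<cdot>\<^sub>v map_vec Re z + Re \<mu> \<cdot>\<^sub>v map_vec Im z"
      unfolding Im_A[OF zc, symmetric] z(3) by auto
  qed
qed

section \<open>The matrix J and the standard symplectic form\<close>

lemma J_mat_carrier: "J_mat n \<in> carrier_mat (2 * n) (2 * n)"
  unfolding J_mat_def mult_2 by (rule four_block_carrier_mat) auto

lemma J_mat_dim [simp]: "dim_row (J_mat n) = 2 * n" "dim_col (J_mat n) = 2 * n"
  using J_mat_carrier[of n] by auto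

lemma J_mat_vec_carrier [simp]:
  "x \<in> carrier_vec (2 * n) \<Longrightarrow> J_mat n *\<^sub>v x \<in> carrier_vec (2 * n)"
  by (rule mult_mat_vec_carrier[OF J_mat_carrier])

lemma J_mat_zero_vec [simp]: "J_mat n *\<^sub>v 0\<^sub>v (2 * n) = 0\<^sub>v (2 * n)"
  by (intro eq_vecI) (auto simp: scalar_prod_def)

lemma transpose_J_mat: "transpose_mat (J_mat n) = - J_mat n"
  unfolding J_mat_def
  by (subst transpose_four_block_mat[of _ n n _ n _ n]) (auto intro!: eq_matI)

lemma J_mat_square: "J_mat n * J_mat n = - 1\<^sub>m (2 * n)"
proof -
  have "J_mat n * J_mat n = four_block_mat (- 1\<^sub>m n) (0\<^sub>m n n) (0\<^sub>m n n) (- 1\<^sub>m n)"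
    unfolding J_mat_def by (subst mult_four_block_mat[of _ n n _ n _ n]) auto
  also have "\<dots> = - 1\<^sub>m (2 * n)" by (intro eq_matI) auto
  finally show ?thesis .
qed

lemma J_mat_J_mat_vec [simp]:
  assumes "x \<in> carrier_vec (2 * n)"
  shows "J_mat n *\<^sub>v (J_mat n *\<^sub>v x) = - x"
proof -
  have "J_mat n *\<^sub>v (J_mat n *\<^sub>v x) = (- 1\<^sub>m (2 * n)) *\<^sub>v x"
    unfolding J_mat_square[symmetric] using assms
    by (intro assoc_mult_mat_vec[OF J_mat_carrier J_mat_carrier, symmetric])
  also have "\<dots> = - x" using assms by simp
  finally show ?thesis .
qed

lemma transpose_scalar_prod:
  fixes A :: "'a :: comm_semiring_0 mat"
  assumes "A \<in> carrier_mat r c" "x \<in> carrier_vec r" "y \<in> carrier_vec c"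
  shows "(transpose_mat A *\<^sub>v x) \<bullet> y = x \<bullet> (A *\<^sub>v y)"
  using assms by (metis assoc_scalar_prod comm_scalar_prod mult_mat_vec_carrier
      transpose_carrier_mat transpose_vec_mult_scalar)

definition symp_form :: "nat \<Rightarrow> real vec \<Rightarrow> real vec \<Rightarrow> real" where
  "symp_form n x y = x \<bullet> (J_mat n *\<^sub>v y)"

lemma J_mat_scalar_prod:
  assumes "x \<in> carrier_vec (2 * n)" "y \<in> carrier_vec (2 * n)"
  shows "(J_mat n *\<^sub>v x) \<bullet> y = - symp_form n x y"
proof -
  have "(- J_mat n *\<^sub>v x) \<bullet> y = symp_form n x y"
    using transpose_scalar_prod[OF J_mat_carrier assms] by (simp add: symp_form_def transpose_J_mat)
  then show ?thesis using assms by simp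
qed

lemma symp_form_skew:
  assumes "x \<in> carrier_vec (2 * n)" "y \<in> carrier_vec (2 * n)"
  shows "symp_form n x y = - symp_form n y x"
  using J_mat_scalar_prod[OF assms(2,1)] comm_scalar_prod[of x "2 * n" "J_mat n *\<^sub>v y"] assms
  by (simp add: symp_form_def)

lemma symp_form_self: "x \<in> carrier_vec (2 * n) \<Longrightarrow> symp_form n x x = 0"
  using symp_form_skew[of x n x] by simp

lemma symp_form_J_mat:
  assumes "x \<in> carrier_vec (2 * n)" "y \<in> carrier_vec (2 * n)"
  shows "symp_form n (J_mat n *\<^sub>v x) y = x \<bullet> y"
  using assms J_mat_scalar_prod[of x n "J_mat n *\<^sub>v y"] by (simp add: symp_form_def)

lemma symp_form_smult [simp]:
  assumes "x \<in> carrier_vec (2 * n)" "y \<in> carrier_vec (2 * n)"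
  shows "symp_form n (c \<cdot>\<^sub>v x) y = c * symp_form n x y" "symp_form n x (c \<cdot>\<^sub>v y) = c * symp_form n x y"
  using assms by (auto simp: symp_form_def mult_mat_vec[OF J_mat_carrier])

lemma symp_form_add_left:
  assumes "x \<in> carrier_vec (2 * n)" "y \<in> carrier_vec (2 * n)" "z \<in> carrier_vec (2 * n)"
  shows "symp_form n (x + y) z = symp_form n x z + symp_form n y z"
  using assms by (simp add: symp_form_def add_scalar_prod_distrib[of _ "2 * n"])

lemma sym_pos_def_scalar_prod:
  assumes "sym_pos_def m M" "x \<in> carrier_vec m" "y \<in> carrier_vec m"
  shows "(M *\<^sub>v x) \<bullet> y = x \<bullet> (M *\<^sub>v y)"
  using assms transpose_scalar_prod[of M m m x y] by (simp add: sym_pos_def_def)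

section \<open>Williamson's theorem, one pair at a time\<close>

text \<open>A partial Williamson normal form made of \<open>m\<close> symplectic pairs. The
  equations for \<open>M\<close> are those of a normalized symplectic eigenvector set, read column
  by column. The order of the values \<open>d i\<close> is left open so that pairs can be appended
  freely.\<close>

definition williamson_family ::
    "nat \<Rightarrow> real mat \<Rightarrow> nat \<Rightarrow> (nat \<Rightarrow> real vec) \<Rightarrow> (nat \<Rightarrow> real vec) \<Rightarrow> (nat \<Rightarrow> real) \<Rightarrow> bool" where
  "williamson_family n M m u v d \<longleftrightarrow>
     (\<forall>i<m. u i \<in> carrier_vec (2 * n) \<and> v i \<in> carrier_vec (2 * n) \<and> 0 < d i \<and>
        M *\<^sub>v u i = d i \<cdot>\<^sub>v (J_mat n *\<^sub>v v i) \<and> M *\<^sub>v v i = (- d i) \<cdot>\<^sub>v (J_mat n *\<^sub>v u i)) \<and>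
     (\<forall>i<m. \<forall>j<m. symp_form n (u i) (u j) = 0 \<and> symp_form n (v i) (v j) = 0 \<and>
        symp_form n (u i) (v j) = (if i = j then 1 else 0))"

lemma williamson_familyD:
  assumes "williamson_family n M m u v d" "i < m"
  shows "u i \<in> carrier_vec (2 * n)" "v i \<in> carrier_vec (2 * n)" "0 < d i"
    "M *\<^sub>v u i = d i \<cdot>\<^sub>v (J_mat n *\<^sub>v v i)" "M *\<^sub>v v i = (- d i) \<cdot>\<^sub>v (J_mat n *\<^sub>v u i)"
    "j < m \<Longrightarrow> symp_form n (u i) (u j) = 0" "j < m \<Longrightarrow> symp_form n (v i) (v j) = 0"
    "j < m \<Longrightarrow> symp_form n (u i) (v j) = (if i = j then 1 else 0)"
  using assms by (simp_all add: williamson_family_def)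

text \<open>The conditions on \<open>w\<close> are \<open>2 * m\<close> linear equations in
  \<open>2 * n\<close> unknowns: \<open>w\<close> is to be orthogonal to all
  \<open>J_mat n *\<^sub>v u i\<close> and \<open>J_mat n *\<^sub>v v i\<close>.\<close>

lemma ex_symp_orthogonal:
  assumes uv: "\<And>i. i < m \<Longrightarrow> u i \<in> carrier_vec (2 * n) \<and> v i \<in> carrier_vec (2 * n)" and "m < n"
  obtains w where "w \<in> carrier_vec (2 * n)" "w \<noteq> 0\<^sub>v (2 * n)"
    "\<And>i. i < m \<Longrightarrow> symp_form n w (u i) = 0 \<and> symp_form n w (v i) = 0"
proof -
  define rs where "rs = map (\<lambda>i. J_mat n *\<^sub>v u i) [0..<m] @ map (\<lambda>i. J_mat n *\<^sub>v v i) [0..<m]"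
  have len: "length rs = 2 * m" by (simp add: rs_def)
  have "mat_of_rows (2 * n) rs \<in> carrier_mat (2 * m) (2 * n)" by (simp flip: len)
  then obtain w where w: "w \<in> carrier_vec (2 * n)" "w \<noteq> 0\<^sub>v (2 * n)"
    "mat_of_rows (2 * n) rs *\<^sub>v w = 0\<^sub>v (2 * m)"
    using wide_mat_kernel[of _ "2 * m" "2 * n"] \<open>m < n\<close> by (metis mult_less_cancel1 zero_less_numeral zero_less_iff_neq_zero)
  have rw: "w \<bullet> r = 0" if "r \<in> set rs" for r
  proof -
    have r: "r \<in> carrier_vec (2 * n)"
      using that uv by (auto simp: rs_def J_mat_vec_carrier)
    obtain i where i: "i < length rs" "rs ! i = r" using \<open>r \<in> set rs\<close> by (meson in_set_conv_nth)
    have "(mat_of_rows (2 * n) rs *\<^sub>v w) $ i = 0" using w(3) i len by simp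
    then have "r \<bullet> w = 0" using i r by simp
    then show ?thesis using comm_scalar_prod[OF r w(1)] by simp
  qed
  show thesis
    by (rule that[OF w(1,2)]) (auto simp: symp_form_def rs_def intro!: rw)
qed

text \<open>The symplectic complement \<open>W\<close> of the given pairs is invariant under
  \<open>T = J_mat n * M\<close>, since pairing \<open>T *\<^sub>v x\<close> with \<open>u i\<close>
  or \<open>v i\<close> gives a multiple of the pairing of \<open>x\<close> with its partner. An
  invariant plane of \<open>T\<close> in \<open>W\<close> yields the new pair after fixing signs and
  scale.\<close>

lemma williamson_family_extend:
  assumes M: "sym_pos_def (2 * n) M" and fam: "williamson_family n M m u v d" and "m < n"
  obtains u' v' d' where "williamson_family n M (Suc m) u' v' d'"
proof -
  have Mc: "M \<in> carrier_mat (2 * n) (2 * n)" using M by (simp add: sym_pos_def_def)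
  note Mv [simp] = mult_mat_vec_carrier[OF Mc]
  note Msym = sym_pos_def_scalar_prod[OF M]
  have Mpos: "0 < x \<bullet> (M *\<^sub>v x)" if "x \<in> carrier_vec (2 * n)" "x \<noteq> 0\<^sub>v (2 * n)" for x
    using M that by (simp add: sym_pos_def_def)
  note fam' = williamson_familyD[OF fam]
  define W where "W = {x \<in> carrier_vec (2 * n). \<forall>i<m. symp_form n x (u i) = 0 \<and> symp_form n x (v i) = 0}"
  define T where "T = J_mat n * M"
  have Tc: "T \<in> carrier_mat (2 * n) (2 * n)" unfolding T_def by (rule mult_carrier_mat[OF J_mat_carrier Mc])
  have T: "T *\<^sub>v x = J_mat n *\<^sub>v (M *\<^sub>v x)" if "x \<in> carrier_vec (2 * n)" for x
    unfolding T_def by (rule assoc_mult_mat_vec[OF J_mat_carrier Mc that])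
  have Wc: "x \<in> carrier_vec (2 * n)" if "x \<in> W" for x using that by (simp add: W_def)
  obtain w where w: "w \<in> W" "w \<noteq> 0\<^sub>v (2 * n)"
  proof (rule ex_symp_orthogonal[of m u n v])
    show "u i \<in> carrier_vec (2 * n) \<and> v i \<in> carrier_vec (2 * n)" if "i < m" for i
      using fam'(1,2) that by simp
  qed (use \<open>m < n\<close> that in \<open>auto simp: W_def\<close>)
  obtain a b \<alpha> \<beta> where ab: "a \<in> W" "b \<in> W" "a \<noteq> 0\<^sub>v (2 * n) \<or> b \<noteq> 0\<^sub>v (2 * n)"
    and Ta: "T *\<^sub>v a = \<alpha> \<cdot>\<^sub>v a + (- \<beta>) \<cdot>\<^sub>v b" and Tb: "T *\<^sub>v b = \<beta> \<cdot>\<^sub>v a + \<alpha> \<cdot>\<^sub>v b"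
  proof (rule real_invariant_plane[OF Tc, of W w])
    show "W \<subseteq> carrier_vec (2 * n)" using Wc by blast
    show "0\<^sub>v (2 * n) \<in> W" using fam'(1,2) by (auto simp: W_def symp_form_def)
    show "x + y \<in> W" if "x \<in> W" "y \<in> W" for x y
      using that fam'(1,2) by (auto simp: W_def symp_form_add_left)
    show "c \<cdot>\<^sub>v x \<in> W" if "x \<in> W" for c x
      using that fam'(1,2) by (auto simp: W_def)
    show "T *\<^sub>v x \<in> W" if x: "x \<in> W" for x
    proof -
      have "symp_form n (T *\<^sub>v x) (u i) = 0 \<and> symp_form n (T *\<^sub>v x) (v i) = 0" if i: "i < m" for i
      proof -
        have "symp_form n (T *\<^sub>v x) y = x \<bullet> (M *\<^sub>v y)" if "y \<in> carrier_vec (2 * n)" for y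
          using Wc[OF x] that by (simp add: T symp_form_J_mat Msym)
        then show ?thesis using x fam'(1-5)[OF i] i by (auto simp: W_def symp_form_def)
      qed
      then show ?thesis using Wc[OF x] T by (auto simp: W_def)
    qed
  qed (use w in auto)
  note abc [simp] = Wc[OF ab(1)] Wc[OF ab(2)]
  define p q r where "p = a \<bullet> (M *\<^sub>v a)" and "q = b \<bullet> (M *\<^sub>v b)" and "r = a \<bullet> (M *\<^sub>v b)"
  have r': "b \<bullet> (M *\<^sub>v a) = r"
    unfolding r_def by (metis Msym abc comm_scalar_prod Mv)
  have "0 \<le> p" "0 \<le> q" "0 < p + q"
    using Mpos[of a] Mpos[of b] ab(3) unfolding p_def q_def
    by (cases "a = 0\<^sub>v (2 * n)"; cases "b = 0\<^sub>v (2 * n)"; force)+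
  \<comment> \<open>The symplectic form vanishes on equal arguments, here
    \<open>M *\<^sub>v a\<close> and \<open>M *\<^sub>v b\<close>. Adding the two resulting
    equations cancels \<open>r\<close> and leaves \<alpha> (p + q) = 0, so the eigenvalue is purely
    imaginary.\<close>
  have "(M *\<^sub>v a) \<bullet> (T *\<^sub>v a) = 0" "(M *\<^sub>v b) \<bullet> (T *\<^sub>v b) = 0"
    using symp_form_self[of "M *\<^sub>v a" n] symp_form_self[of "M *\<^sub>v b" n] by (simp_all add: symp_form_def T)
  then have "\<alpha> * p - \<beta> * r = 0" "\<beta> * r + \<alpha> * q = 0"
    unfolding Ta Tb
    by (simp_all add: scalar_prod_add_distrib[of _ "2 * n"] Msym mult_mat_vec[OF Mc]
        scalar_prod_smult_distrib[of _ "2 * n"] p_def q_def r'[unfolded r_def] r_def)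
  then have "\<alpha> * (p + q) = 0" by (simp add: algebra_simps)
  then have "\<alpha> = 0" using \<open>0 < p + q\<close> by simp
  have Ja: "J_mat n *\<^sub>v (M *\<^sub>v a) = (- \<beta>) \<cdot>\<^sub>v b" and Jb: "J_mat n *\<^sub>v (M *\<^sub>v b) = \<beta> \<cdot>\<^sub>v a"
  proof -
    have "0 \<cdot>\<^sub>v x = 0\<^sub>v (2 * n)" if "x \<in> carrier_vec (2 * n)" for x :: "real vec"
      using that by auto
    then show "J_mat n *\<^sub>v (M *\<^sub>v a) = (- \<beta>) \<cdot>\<^sub>v b" "J_mat n *\<^sub>v (M *\<^sub>v b) = \<beta> \<cdot>\<^sub>v a"
      using Ta Tb T \<open>\<alpha> = 0\<close> by simp_all
  qed
  \<comment> \<open>One more application of J, whose square is minus the identity, solves for the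
    images under \<open>M\<close>.\<close>
  have "- (M *\<^sub>v a) = (- \<beta>) \<cdot>\<^sub>v (J_mat n *\<^sub>v b)" "- (M *\<^sub>v b) = \<beta> \<cdot>\<^sub>v (J_mat n *\<^sub>v a)"
    using arg_cong[OF Ja, of "(*\<^sub>v) (J_mat n)"] arg_cong[OF Jb, of "(*\<^sub>v) (J_mat n)"]
    by (simp_all add: mult_mat_vec[OF J_mat_carrier])
  then have "- (- (M *\<^sub>v a)) = - ((- \<beta>) \<cdot>\<^sub>v (J_mat n *\<^sub>v b))" "- (- (M *\<^sub>v b)) = - (\<beta> \<cdot>\<^sub>v (J_mat n *\<^sub>v a))"
    by simp_all
  then have Ma: "M *\<^sub>v a = \<beta> \<cdot>\<^sub>v (J_mat n *\<^sub>v b)" and Mb: "M *\<^sub>v b = (- \<beta>) \<cdot>\<^sub>v (J_mat n *\<^sub>v a)"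
    by auto
  have "p = \<beta> * symp_form n a b" unfolding p_def Ma by (simp add: symp_form_def)
  moreover have "q = \<beta> * symp_form n a b"
    unfolding q_def Mb using symp_form_skew[of a n b] by (simp add: symp_form_def)
  ultimately have pos: "0 < \<beta> * symp_form n a b" using \<open>0 < p + q\<close> by simp
  \<comment> \<open>Exchanging \<open>a\<close> and \<open>b\<close> flips the sign of both \<beta>
    and \<open>symp_form n a b\<close>. Their product is positive, so one of the two orders makes
    both positive.\<close>
  obtain a' b' \<beta>' where ab': "a' \<in> W" "b' \<in> W" "0 < \<beta>'" "0 < symp_form n a' b'"
    "M *\<^sub>v a' = \<beta>' \<cdot>\<^sub>v (J_mat n *\<^sub>v b')" "M *\<^sub>v b' = (- \<beta>') \<cdot>\<^sub>v (J_mat n *\<^sub>v a')"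
  proof (cases "0 < \<beta>")
    case True
    then show thesis using that[of a b \<beta>] ab Ma Mb pos by (simp add: zero_less_mult_iff)
  next
    case False
    then have "\<beta> < 0" "symp_form n a b < 0" using pos by (auto simp: zero_less_mult_iff)
    then show thesis using that[of b a "- \<beta>"] ab Ma Mb symp_form_skew[of a n b] by simp
  qed
  note abc' [simp] = Wc[OF ab'(1)] Wc[OF ab'(2)]
  \<comment> \<open>A common factor preserves the linear equations and multiplies the symplectic
    product by its square, which normalizes it to 1.\<close>
  define c where "c = 1 / sqrt (symp_form n a' b')"
  have cc: "c * (c * symp_form n a' b') = 1" using ab'(4) by (simp add: c_def field_simps)
  have "M *\<^sub>v (c \<cdot>\<^sub>v a') = \<beta>' \<cdot>\<^sub>v (J_mat n *\<^sub>v (c \<cdot>\<^sub>v b'))"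
    "M *\<^sub>v (c \<cdot>\<^sub>v b') = (- \<beta>') \<cdot>\<^sub>v (J_mat n *\<^sub>v (c \<cdot>\<^sub>v a'))"
    by (simp_all add: mult_mat_vec[OF Mc] mult_mat_vec[OF J_mat_carrier] ab'(5,6)
        smult_smult_assoc mult.commute[of c])
  note new = this ab'(3) cc
  have W0: "symp_form n x (u i) = 0" "symp_form n x (v i) = 0" "symp_form n (u i) x = 0" "symp_form n (v i) x = 0"
    if "x \<in> W" "i < m" for x i
    using that symp_form_skew[of "u i" n x] symp_form_skew[of "v i" n x] fam'(1,2)[of i] by (auto simp: W_def)
  show thesis
  proof (rule that)
    show "williamson_family n M (Suc m) (u(m := c \<cdot>\<^sub>v a')) (v(m := c \<cdot>\<^sub>v b')) (d(m := \<beta>'))"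
      unfolding williamson_family_def
      using fam' new W0[OF ab'(1)] W0[OF ab'(2)] by (auto simp: less_Suc_eq symp_form_self)
  qed
qed

lemma ex_williamson_family:
  assumes "sym_pos_def (2 * n) M"
  obtains u v d where "williamson_family n M n u v d"
proof -
  have "\<exists>u v d. williamson_family n M m u v d" if "m \<le> n" for m
    using that
  proof (induction m)
    case 0
    then show ?case by (simp add: williamson_family_def)
  next
    case (Suc m)
    then show ?case using williamson_family_extend[OF assms] by (metis Suc_leD Suc_le_eq)
  qed
  then show thesis using that by blast
qed

text \<open>The conditions on a family survive a permutation of its pairs, so sorting the indices by
  \<open>d\<close> provides the ascending order that \<open>symplectic_spectrum\<close>
  demands.\<close>

lemma ex_sorted_williamson_family:
  assumes "sym_pos_def (2 * n) M"
  obtains u v d where "williamson_family n M n u v d" "\<And>i j. i \<le> j \<Longrightarrow> j < n \<Longrightarrow> d i \<le> d j"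
proof -
  obtain u v d where fam: "williamson_family n M n u v d"
    using ex_williamson_family[OF assms] by blast
  define s where "s = sort_key d [0..<n]"
  have len: "length s = n" by (simp add: s_def)
  have bound: "s ! i < n" if "i < n" for i
    using nth_mem[of i s] that by (simp add: s_def)
  have "distinct s" by (simp add: s_def)
  then have inj: "s ! i = s ! j \<longleftrightarrow> i = j" if "i < n" "j < n" for i j
    using that len by (simp add: nth_eq_iff_index_eq)
  show thesis
  proof (rule that[of "\<lambda>i. u (s ! i)" "\<lambda>i. v (s ! i)" "\<lambda>i. d (s ! i)"])
    show "williamson_family n M n (\<lambda>i. u (s ! i)) (\<lambda>i. v (s ! i)) (\<lambda>i. d (s ! i))"
      using fam bound inj by (simp add: williamson_family_def)
    show "d (s ! i) \<le> d (s ! j)" if "i \<le> j" "j < n" for i j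
    proof -
      have "sorted (map d s)" unfolding s_def by (rule sorted_sort_key)
      from sorted_nth_mono[OF this, of i j] show ?thesis using that len by simp
    qed
  qed
qed

section \<open>From families of pairs to symplectic matrices\<close>

text \<open>Placing all \<open>u\<close> before all \<open>v\<close> matches the block form of
  \<open>J_mat\<close>.\<close>

definition pair_mat :: "nat \<Rightarrow> nat \<Rightarrow> (nat \<Rightarrow> 'a vec) \<Rightarrow> (nat \<Rightarrow> 'a vec) \<Rightarrow> 'a mat" where
  "pair_mat r k u v = mat r (2 * k) (\<lambda>(i, j). if j < k then u j $ i else v (j - k) $ i)"

lemma pair_mat_carrier [simp]: "pair_mat r k u v \<in> carrier_mat r (2 * k)"
  by (simp add: pair_mat_def)

lemma col_pair_mat:
  assumes "\<And>i. i < k \<Longrightarrow> u i \<in> carrier_vec r" "\<And>i. i < k \<Longrightarrow> v i \<in> carrier_vec r" "j < 2 * k"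
  shows "col (pair_mat r k u v) j = (if j < k then u j else v (j - k))"
proof -
  have "j - k < k" if "\<not> j < k" using that assms(3) by simp
  then have "dim_vec (if j < k then u j else v (j - k)) = r"
    using assms by (metis carrier_vecD)
  then show ?thesis using assms(3) by (auto simp: pair_mat_def)
qed

text \<open>One block computation serves for \<open>B\<close> being J, the form matrix itself, the
  identity and the Lagrange multiplier.\<close>

lemma pair_mat_congruence:
  fixes B :: "'a :: comm_ring_1 mat"
  assumes uv: "\<And>i. i < k \<Longrightarrow> u i \<in> carrier_vec r" "\<And>i. i < k \<Longrightarrow> v i \<in> carrier_vec r"
    and B: "B \<in> carrier_mat r r"
  shows "transpose_mat (pair_mat r k u v) * B * pair_mat r k u v =
    four_block_mat (mat k k (\<lambda>(i, j). u i \<bullet> (B *\<^sub>v u j))) (mat k k (\<lambda>(i, j). u i \<bullet> (B *\<^sub>v v j)))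
      (mat k k (\<lambda>(i, j). v i \<bullet> (B *\<^sub>v u j))) (mat k k (\<lambda>(i, j). v i \<bullet> (B *\<^sub>v v j)))"
    (is "transpose_mat ?S * B * ?S = ?R")
proof -
  have S: "?S \<in> carrier_mat r (2 * k)" by simp
  have "transpose_mat ?S * B * ?S = transpose_mat ?S * (B * ?S)"
    using S B by (metis assoc_mult_mat transpose_carrier_mat)
  also have "\<dots> = ?R"
  proof (intro eq_matI)
    fix i j assume "i < dim_row ?R" "j < dim_col ?R"
    then have ij: "i < 2 * k" "j < 2 * k" by auto
    have "(transpose_mat ?S * (B * ?S)) $$ (i, j) = col ?S i \<bullet> (B *\<^sub>v col ?S j)"
      using ij B S col_mult2[OF B S ij(2)]
      by (metis carrier_matD index_mult_mat(1,2,3) index_transpose_mat(2) row_transpose)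
    also have "\<dots> = ?R $$ (i, j)" using ij by (auto simp: col_pair_mat[OF uv])
    finally show "(transpose_mat ?S * (B * ?S)) $$ (i, j) = ?R $$ (i, j)" .
  qed (auto simp: pair_mat_def)
  finally show ?thesis .
qed

text \<open>By the equations for \<open>M\<close>, the entries of both congruences are values of the
  symplectic form up to factors \<open>d j\<close> and signs. For \<open>m = n\<close>, with the
  existence of a sorted family, this is Williamson's theorem.\<close>

lemma williamson_family_pair_mat:
  assumes M: "M \<in> carrier_mat (2 * n) (2 * n)" and fam: "williamson_family n M m u v d"
  defines "S \<equiv> pair_mat (2 * n) m u v"
  shows "S \<in> Sp m n"
    "transpose_mat S * M * S = four_block_mat (mat_diag m d) (0\<^sub>m m m) (0\<^sub>m m m) (mat_diag m d)"
proof -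
  note fam' = williamson_familyD[OF fam]
  have vu: "symp_form n (v i) (u j) = (if i = j then - 1 else 0)" if "i < m" "j < m" for i j
    using symp_form_skew[of "v i" n "u j"] fam' that by auto
  have "transpose_mat S * J_mat n * S = J_mat m"
    unfolding S_def
    by (subst pair_mat_congruence[OF fam'(1,2) J_mat_carrier])
       (auto simp: J_mat_def[of m] fam' vu simp flip: symp_form_def intro!: cong_four_block_mat eq_matI)
  then show "S \<in> Sp m n" by (simp add: Sp_def S_def)
  show "transpose_mat S * M * S = four_block_mat (mat_diag m d) (0\<^sub>m m m) (0\<^sub>m m m) (mat_diag m d)"
    unfolding S_def
    by (subst pair_mat_congruence[OF fam'(1,2) M])
       (auto simp: fam' vu mat_diag_def J_mat_vec_carrier simp flip: symp_form_def
         intro!: cong_four_block_mat eq_matI)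
qed

text \<open>
  Stated through dimensions, these rewrite without having to guess the carriers of the factors.
\<close>

lemma mult_mat_dim_simps:
  fixes A B C :: "'a :: comm_semiring_0 mat"
  shows "dim_col A = dim_row B \<Longrightarrow> dim_col B = dim_row C \<Longrightarrow> A * B * C = A * (B * C)"
    and "dim_col A = dim_row B \<Longrightarrow> dim_col B = dim_vec v \<Longrightarrow> A * B *\<^sub>v v = A *\<^sub>v (B *\<^sub>v v)"
    and "dim_col A = dim_row B \<Longrightarrow> transpose_mat (A * B) = transpose_mat B * transpose_mat A"
  by (metis assoc_mult_mat carrier_mat_triv, metis assoc_mult_mat_vec carrier_mat_triv carrier_vec_dim_vec,
      metis transpose_mult carrier_mat_triv)

section \<open>Nondegeneracy and recognition of symplectic eigenvalues\<close>

text \<open>Multiplying \<open>X *\<^sub>v z = 0\<close> by X^T J gives J z = 0, and J is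
  invertible.\<close>

lemma Sp_kernel:
  assumes X: "X \<in> Sp k n" and z: "z \<in> carrier_vec (2 * k)" and "X *\<^sub>v z = 0\<^sub>v (2 * n)"
  shows "z = 0\<^sub>v (2 * k)"
proof -
  have Xc: "X \<in> carrier_mat (2 * n) (2 * k)" and XJ: "transpose_mat X * J_mat n * X = J_mat k"
    using X by (auto simp: Sp_def)
  have "J_mat k *\<^sub>v z = transpose_mat X *\<^sub>v (J_mat n *\<^sub>v (X *\<^sub>v z))"
    unfolding XJ[symmetric] using carrier_matD[OF Xc] z by (simp add: mult_mat_dim_simps)
  also have "\<dots> = 0\<^sub>v (2 * k)"
    unfolding assms(3) using Xc by (auto intro!: eq_vecI)
  finally have "- z = J_mat k *\<^sub>v 0\<^sub>v (2 * k)" using J_mat_J_mat_vec[OF z] by metis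
  then have "- (- z) = - 0\<^sub>v (2 * k)" by simp
  then show ?thesis using z by auto
qed

text \<open>The hypothesis says S^T J y = 0, and both S^T and J are invertible.\<close>

lemma Sp_nondegenerate:
  assumes S: "S \<in> Sp n n" and y: "y \<in> carrier_vec (2 * n)"
    and 0: "\<And>i. i < 2 * n \<Longrightarrow> symp_form n (col S i) y = 0"
  shows "y = 0\<^sub>v (2 * n)"
proof -
  have Sc: "S \<in> carrier_mat (2 * n) (2 * n)"
    using S by (auto simp: Sp_def)
  have "det S \<noteq> 0" using Sp_kernel[OF S] det_0_iff_vec_prod_zero_field[OF Sc] by blast
  then have "det (transpose_mat S) \<noteq> 0" by (simp add: det_transpose[OF Sc])
  moreover have "transpose_mat S *\<^sub>v (J_mat n *\<^sub>v y) = 0\<^sub>v (2 * n)"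
    using 0 Sc by (intro eq_vecI) (auto simp: symp_form_def)
  ultimately have "J_mat n *\<^sub>v y = 0\<^sub>v (2 * n)"
    using det_0_iff_vec_prod_zero_field[of "transpose_mat S" "2 * n"] Sc J_mat_vec_carrier[OF y]
    by (metis transpose_carrier_mat)
  then have "- y = J_mat n *\<^sub>v 0\<^sub>v (2 * n)" using J_mat_J_mat_vec[OF y] by metis
  then have "- (- y) = - 0\<^sub>v (2 * n)" by simp
  then show ?thesis using y by auto
qed

text \<open>If \<open>l\<close> differed from every \<open>d i\<close> of a Williamson normal form,
  then \<open>y\<close> would be symplectically orthogonal to all of its pairs and hence zero. This
  later identifies values found for the compressed matrix X^T M X as symplectic eigenvalues of
  \<open>M\<close>.\<close>

lemma symplectic_eigenvalueI:
  assumes M: "sym_pos_def (2 * n) M"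
    and y: "y \<in> carrier_vec (2 * n)" "y \<noteq> 0\<^sub>v (2 * n)" and w: "w \<in> carrier_vec (2 * n)"
    and My: "M *\<^sub>v y = l \<cdot>\<^sub>v (J_mat n *\<^sub>v w)" and Mw: "M *\<^sub>v w = (- l) \<cdot>\<^sub>v (J_mat n *\<^sub>v y)"
    and "0 < l"
  shows "symplectic_eigenvalue n M l"
proof -
  have Mc: "M \<in> carrier_mat (2 * n) (2 * n)" using M by (simp add: sym_pos_def_def)
  obtain u v d where fam: "williamson_family n M n u v d"
    and sorted: "\<And>i j. i \<le> j \<Longrightarrow> j < n \<Longrightarrow> d i \<le> d j"
    using ex_sorted_williamson_family[OF M] by blast
  note fam' = williamson_familyD[OF fam]
  have "symplectic_spectrum n M d"
    using williamson_family_pair_mat[OF Mc fam] fam'(3) sorted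
    unfolding symplectic_spectrum_def by blast
  moreover have "\<exists>i<n. l = d i"
  proof (rule ccontr)
    assume "\<not> ?thesis"
    then have ne: "l \<noteq> d i" if "i < n" for i using that by blast
    have perp: "symp_form n (u i) y = 0 \<and> symp_form n (v i) y = 0" if i: "i < n" for i
    proof -
      note f = fam'(1-5)[OF i]
      have sym: "(M *\<^sub>v a) \<bullet> b = a \<bullet> (M *\<^sub>v b)"
        if "a \<in> carrier_vec (2 * n)" "b \<in> carrier_vec (2 * n)" for a b
        using sym_pos_def_scalar_prod[OF M that] .
      note smult = smult_scalar_prod_distrib[of _ "2 * n"] scalar_prod_smult_distrib[of _ "2 * n"]
      \<comment> \<open>Each of the four relations moves \<open>M\<close> across the product of one
        of \<open>u i\<close>, \<open>v i\<close> with one of \<open>y\<close>,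
        \<open>w\<close>.\<close>
      have uw: "l * symp_form n (u i) w = - (d i * symp_form n (v i) y)"
        using sym[of "u i" y] f(1,2) y(1) w
        by (simp add: My f(4) smult J_mat_scalar_prod flip: symp_form_def)
      have vw: "l * symp_form n (v i) w = d i * symp_form n (u i) y"
        using sym[of "v i" y] f(1,2) y(1) w
        by (simp add: My f(5) smult J_mat_scalar_prod flip: symp_form_def)
      have uy: "l * symp_form n (u i) y = d i * symp_form n (v i) w"
        using sym[of "u i" w] f(1,2) y(1) w
        by (simp add: Mw f(4) smult J_mat_scalar_prod flip: symp_form_def)
      have vy: "l * symp_form n (v i) y = - (d i * symp_form n (u i) w)"
        using sym[of "v i" w] f(1,2) y(1) w
        by (simp add: Mw f(5) smult J_mat_scalar_prod flip: symp_form_def)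
      \<comment> \<open>Two relations used in turn eliminate \<open>w\<close> and leave an equation
        in \<open>y\<close> alone.\<close>
      have "l * (l * symp_form n (u i) y) = d i * (l * symp_form n (v i) w)"
        unfolding uy by simp
      then have "l\<^sup>2 * symp_form n (u i) y = (d i)\<^sup>2 * symp_form n (u i) y"
        unfolding vw by (simp add: power2_eq_square)
      moreover have "l * (l * symp_form n (v i) y) = - (d i * (l * symp_form n (u i) w))"
        unfolding vy by simp
      then have "l\<^sup>2 * symp_form n (v i) y = (d i)\<^sup>2 * symp_form n (v i) y"
        unfolding uw by (simp add: power2_eq_square)
      \<comment> \<open>Both numbers are positive, so distinct values have distinct squares.\<close>
      moreover have "l\<^sup>2 \<noteq> (d i)\<^sup>2"
        using ne[OF i] \<open>0 < l\<close> f(3) by (simp add: power2_eq_iff)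
      ultimately show ?thesis by simp
    qed
    have "y = 0\<^sub>v (2 * n)"
    proof (rule Sp_nondegenerate[OF williamson_family_pair_mat(1)[OF Mc fam] y(1)])
      fix j assume "j < 2 * n"
      then show "symp_form n (col (pair_mat (2 * n) n u v) j) y = 0"
        using perp[of j] perp[of "j - n"]
        by (subst col_pair_mat[OF fam'(1,2)]) auto
    qed
    with y show False by blast
  qed
  ultimately show ?thesis unfolding symplectic_eigenvalue_def by blast
qed

section \<open>Orthogonal symplectic matrices and critical points\<close>

text \<open>
  Here \<open>u i\<close> is an eigenvector of \<open>A\<^sup>2\<close> for \<open>(d i)\<^sup>2\<close>, so positivity of \<open>A\<close> makes it an
  eigenvector of \<open>A\<close> for \<open>d i\<close>.
\<close>

lemma williamson_family_commuting:
  assumes A: "sym_pos_def (2 * n) A" and comm: "J_mat n * A = A * J_mat n"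
    and fam: "williamson_family n A m u v d" and i: "i < m"
  shows "J_mat n *\<^sub>v v i = u i"
proof -
  have Ac: "A \<in> carrier_mat (2 * n) (2 * n)" using A by (simp add: sym_pos_def_def)
  note Av [simp] = mult_mat_vec_carrier[OF Ac]
  note f [simp] = williamson_familyD(1-5)[OF fam i]
  have AJ: "A *\<^sub>v (J_mat n *\<^sub>v x) = J_mat n *\<^sub>v (A *\<^sub>v x)" if "x \<in> carrier_vec (2 * n)" for x
    using comm that Ac J_mat_carrier[of n] by (metis assoc_mult_mat_vec)
  \<comment> \<open>The difference that should vanish satisfies A x = - d i x, which positive
    definiteness permits only for x = 0.\<close>
  define x where "x = J_mat n *\<^sub>v v i - u i"
  have x [simp]: "x \<in> carrier_vec (2 * n)" by (simp add: x_def)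
  have "A *\<^sub>v x = J_mat n *\<^sub>v (A *\<^sub>v v i) - A *\<^sub>v u i"
    by (simp add: x_def mult_minus_distrib_mat_vec[OF Ac] AJ)
  also have "J_mat n *\<^sub>v (A *\<^sub>v v i) = d i \<cdot>\<^sub>v u i"
    by (simp add: mult_mat_vec[OF J_mat_carrier]) (auto intro!: eq_vecI)
  also have "d i \<cdot>\<^sub>v u i - A *\<^sub>v u i = (- d i) \<cdot>\<^sub>v x"
    using carrier_vecD[OF f(1)] f(4) by (auto simp: x_def algebra_simps intro!: eq_vecI)
  finally have "x \<bullet> (A *\<^sub>v x) = - d i * (x \<bullet> x)" by simp
  moreover have "0 \<le> x \<bullet> x" by (auto simp: scalar_prod_def intro!: sum_nonneg)
  then have "0 \<le> d i * (x \<bullet> x)" using less_imp_le[OF f(3)] by (rule mult_nonneg_nonneg[rotated])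
  ultimately have "x = 0\<^sub>v (2 * n)"
    using A x by (force simp: sym_pos_def_def)
  then have "\<And>j. j < 2 * n \<Longrightarrow> (J_mat n *\<^sub>v v i - u i) $ j = 0" by (simp add: x_def)
  moreover have "dim_vec (u i) = 2 * n" using carrier_vecD[OF f(1)] .
  ultimately show ?thesis by (intro eq_vecI) (simp_all only: J_mat_dim dim_mult_mat_vec index_minus_vec right_minus_eq)
qed

text \<open>A left inverse of a square matrix is a right inverse. Multiplying K^T J K = J by
  \<open>K\<close> on the left and its transpose on the right then gives the symplectic condition
  for the transpose.\<close>

lemma OrSp_transpose:
  assumes "K \<in> OrSp k"
  shows "transpose_mat K \<in> OrSp k" "K * transpose_mat K = 1\<^sub>m (2 * k)"
proof -
  have K: "K \<in> carrier_mat (2 * k) (2 * k)" and KJ: "transpose_mat K * J_mat k * K = J_mat k"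
    and KK: "transpose_mat K * K = 1\<^sub>m (2 * k)"
    using assms by (auto simp: OrSp_def Sp_def)
  have KT: "transpose_mat K \<in> carrier_mat (2 * k) (2 * k)" using K by simp
  show KK': "K * transpose_mat K = 1\<^sub>m (2 * k)"
    by (rule mat_mult_left_right_inverse[OF KT K KK])
  have "K * J_mat k * transpose_mat K = K * (transpose_mat K * J_mat k * K) * transpose_mat K"
    by (simp only: KJ)
  also have "\<dots> = (K * transpose_mat K) * J_mat k * (K * transpose_mat K)"
    using carrier_matD[OF K] by (simp add: mult_mat_dim_simps)
  also have "\<dots> = J_mat k" unfolding KK' by simp
  finally show "transpose_mat K \<in> OrSp k"
    using K KK' by (simp add: OrSp_def Sp_def)
qed

text \<open>If \<open>L\<close> is the block matrix of eigenvalues belonging to \<open>X\<close>,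
  then K^T L K is a multiplier for \<open>X * K\<close>: it is again skew-symmetric, and K K^T = 1
  removes the inner factors.\<close>

lemma critical_point_mult_OrSp:
  assumes M: "M \<in> carrier_mat (2 * n) (2 * n)" and K: "K \<in> OrSp k"
    and X: "normalized_symplectic_eigenvector_set n k M X"
  shows "critical_point n k M (X * K)"
proof -
  obtain l where Xc: "X \<in> carrier_mat (2 * n) (2 * k)"
    and XJ: "transpose_mat X * J_mat n * X = J_mat k"
    and MX: "M * X = J_mat n * X * four_block_mat (0\<^sub>m k k) (- mat_diag k l) (mat_diag k l) (0\<^sub>m k k)"
    using X unfolding normalized_symplectic_eigenvector_set_def
      normalized_symplectic_eigenvector_set_for_def Sp_def by blast
  define L where "L = four_block_mat (0\<^sub>m k k) (- mat_diag k l) (mat_diag k l) (0\<^sub>m k k)"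
  have Lc: "L \<in> carrier_mat (2 * k) (2 * k)"
    unfolding L_def mult_2 by (rule four_block_carrier_mat) auto
  have LT: "transpose_mat L = - L"
    unfolding L_def
    by (subst transpose_four_block_mat[of _ k k _ k _ k]) (auto simp: mat_diag_def intro!: eq_matI)
  have Kc: "K \<in> carrier_mat (2 * k) (2 * k)" and KJ: "transpose_mat K * J_mat k * K = J_mat k"
    using K by (auto simp: OrSp_def Sp_def)
  note c = M Xc Kc Lc J_mat_carrier[of n] J_mat_carrier[of k]
  note [simp] = mult_mat_dim_simps carrier_matD[OF M] carrier_matD[OF Xc] carrier_matD[OF Kc]
    carrier_matD[OF Lc]
  define L' where "L' = transpose_mat K * L * K"
  have "transpose_mat (X * K) * J_mat n * (X * K) =
      transpose_mat K * (transpose_mat X * J_mat n * X) * K"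
    by simp
  then have "transpose_mat (X * K) * J_mat n * (X * K) = J_mat k" using XJ KJ by simp
  moreover have "transpose_mat L' = - L'"
    by (simp add: L'_def LT)
  moreover have "M * (X * K) = J_mat n * (X * K) * L'"
  proof -
    have "J_mat n * (X * K) * L' = J_mat n * X * (K * transpose_mat K) * L * K"
      using c by (simp add: L'_def)
    also have "\<dots> = J_mat n * X * L * K"
      using c by (simp add: OrSp_transpose(2)[OF K])
    also have "\<dots> = M * X * K" unfolding MX L_def ..
    also have "\<dots> = M * (X * K)" by simp
    finally show ?thesis ..
  qed
  moreover have "L' \<in> carrier_mat (2 * k) (2 * k)" using c by (simp add: L'_def)
  ultimately show ?thesis using c unfolding critical_point_def by auto
qed

text \<open>The Williamson matrix \<open>S\<close> of A = X^T M X is orthogonal, so the congruence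
  S^T L S is also a change of basis and brings the multiplier to the required block form. The
  witnesses are \<open>Y = X * S\<close> and the transpose of \<open>S\<close> for
  \<open>K\<close>.\<close>

lemma critical_point_factorization:
  assumes M: "sym_pos_def (2 * n) M" and X: "critical_point n k M X"
  obtains Y K where "K \<in> OrSp k" "Y \<in> Sp k n" "normalized_symplectic_eigenvector_set n k M Y" "X = Y * K"
proof -
  obtain L where Xc: "X \<in> carrier_mat (2 * n) (2 * k)" and XJ: "transpose_mat X * J_mat n * X = J_mat k"
    and Lc: "L \<in> carrier_mat (2 * k) (2 * k)" and LT: "transpose_mat L = - L"
    and MX: "M * X = J_mat n * X * L"
    using X unfolding critical_point_def by blast
  have XSp: "X \<in> Sp k n" using Xc XJ by (simp add: Sp_def)
  have Mc: "M \<in> carrier_mat (2 * n) (2 * n)" and MT: "transpose_mat M = M"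
    using M by (auto simp: sym_pos_def_def)
  note c = Mc Xc Lc J_mat_carrier[of n] J_mat_carrier[of k]
  note [simp] = mult_mat_dim_simps carrier_matD[OF Mc] carrier_matD[OF Xc] carrier_matD[OF Lc]
  define A where "A = transpose_mat X * M * X"
  have Ac: "A \<in> carrier_mat (2 * k) (2 * k)" using c by (simp add: A_def)
  have AT: "transpose_mat A = A"
    by (simp add: A_def MT)
  have "A = transpose_mat X * (M * X)" using c by (simp add: A_def)
  also have "\<dots> = (transpose_mat X * J_mat n * X) * L" using c by (simp add: MX)
  finally have AJL: "A = J_mat k * L" unfolding XJ .
  \<comment> \<open>Both factors are skew-symmetric, so transposing J L swaps them. As
    \<open>A\<close> is symmetric, this gives A = J L = L J, whence \<open>A\<close> commutes with
    J.\<close>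
  have "transpose_mat (J_mat k * L) = L * J_mat k"
    by (simp add: transpose_J_mat LT)
  then have ALJ: "A = L * J_mat k" using AT AJL by simp
  have comm: "J_mat k * A = A * J_mat k"
  proof -
    have "J_mat k * A = J_mat k * L * J_mat k" unfolding ALJ using c by simp
    then show ?thesis unfolding AJL[symmetric] .
  qed
  have Apd: "sym_pos_def (2 * k) A"
    unfolding sym_pos_def_def
  proof (intro conjI ballI impI)
    fix z :: "real vec" assume z: "z \<in> carrier_vec (2 * k)" "z \<noteq> 0\<^sub>v (2 * k)"
    have Xz: "X *\<^sub>v z \<in> carrier_vec (2 * n)" using Xc z by simp
    have "A *\<^sub>v z = transpose_mat X *\<^sub>v (M *\<^sub>v (X *\<^sub>v z))" unfolding A_def using c z by simp
    then have "z \<bullet> (A *\<^sub>v z) = (X *\<^sub>v z) \<bullet> (M *\<^sub>v (X *\<^sub>v z))"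
      using transpose_scalar_prod[of "transpose_mat X" "2 * k" "2 * n" z "M *\<^sub>v (X *\<^sub>v z)"] c z Xz
      by simp
    moreover have "X *\<^sub>v z \<noteq> 0\<^sub>v (2 * n)" using Sp_kernel[OF XSp] z by blast
    ultimately show "0 < z \<bullet> (A *\<^sub>v z)" using M Xz by (simp add: sym_pos_def_def)
  qed (use Ac AT in auto)
  obtain u v d where fam: "williamson_family k A k u v d" using ex_williamson_family[OF Apd] by blast
  note fam' = williamson_familyD[OF fam]
  have Jv: "J_mat k *\<^sub>v v i = u i" if "i < k" for i
    by (rule williamson_family_commuting[OF Apd comm fam that])
  have Ju: "J_mat k *\<^sub>v u i = - v i" if "i < k" for i
    using J_mat_J_mat_vec[of "v i" k] Jv fam'(2) that by simp
  \<comment> \<open>Since J v j = u j, the symplectic relations among the pairs turn into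
    orthonormality of all the vectors.\<close>
  have uu: "u i \<bullet> u j = (if i = j then 1 else 0)" if "i < k" "j < k" for i j
    using fam'(8)[OF that(1), of j] that Jv by (simp add: symp_form_def)
  have vu: "v i \<bullet> u j = 0" if "i < k" "j < k" for i j
    using fam'(7)[OF that(1), of j] that Jv by (simp add: symp_form_def)
  have uv: "u i \<bullet> v j = 0" if "i < k" "j < k" for i j
    using vu[OF that(2,1)] comm_scalar_prod[of "u i" "2 * k" "v j"] fam' that by simp
  have vv: "v i \<bullet> v j = (if i = j then 1 else 0)" if "i < k" "j < k" for i j
  proof -
    have "v i \<bullet> v j = - (v i \<bullet> (J_mat k *\<^sub>v u j))"
      using carrier_vecD[OF fam'(2)[OF that(1)]] carrier_vecD[OF fam'(2)[OF that(2)]]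
      by (simp add: Ju that)
    also have "\<dots> = symp_form k (u j) (v i)"
      using symp_form_skew[of "v i" k "u j"] fam' that by (simp add: symp_form_def)
    finally show ?thesis using fam'(8)[OF that(2), of i] that by auto
  qed
  \<comment> \<open>Solving A = J L for the multiplier transfers its action on the pairs from that
    of \<open>A\<close>.\<close>
  have L: "L *\<^sub>v x = - (J_mat k *\<^sub>v (A *\<^sub>v x))" if "x \<in> carrier_vec (2 * k)" for x
  proof -
    have "A *\<^sub>v x = J_mat k *\<^sub>v (L *\<^sub>v x)" unfolding AJL using c that by simp
    then show ?thesis using Lc that by simp
  qed
  have Lu: "L *\<^sub>v u i = d i \<cdot>\<^sub>v v i" if "i < k" for i
  proof -
    have "L *\<^sub>v u i = - (d i \<cdot>\<^sub>v - v i)"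
      using fam'[OF that] that by (simp add: L mult_mat_vec[OF J_mat_carrier])
    then show ?thesis by auto
  qed
  have Lv: "L *\<^sub>v v i = (- d i) \<cdot>\<^sub>v u i" if "i < k" for i
  proof -
    have "L *\<^sub>v v i = - ((- d i) \<cdot>\<^sub>v - u i)"
      using fam'[OF that] that by (simp add: L mult_mat_vec[OF J_mat_carrier])
    then show ?thesis by auto
  qed
  define S where "S = pair_mat (2 * k) k u v"
  have Sc: "S \<in> carrier_mat (2 * k) (2 * k)" and ST: "transpose_mat S \<in> carrier_mat (2 * k) (2 * k)"
    by (simp_all add: S_def pair_mat_def)
  have "transpose_mat S * S = transpose_mat S * 1\<^sub>m (2 * k) * S"
    using Sc ST by simp
  also have "\<dots> = four_block_mat (1\<^sub>m k) (0\<^sub>m k k) (0\<^sub>m k k) (1\<^sub>m k)"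
    unfolding S_def
    by (subst pair_mat_congruence[OF fam'(1,2)])
       (auto simp: fam' uu uv vu vv intro!: cong_four_block_mat eq_matI)
  finally have SS: "transpose_mat S * S = 1\<^sub>m (2 * k)" by (simp add: mult_2)
  have SSp: "S \<in> Sp k k" using williamson_family_pair_mat(1)[OF Ac fam] by (simp add: S_def)
  then have SOr: "S \<in> OrSp k" using SS by (simp add: OrSp_def)
  define Lam where "Lam = four_block_mat (0\<^sub>m k k) (- mat_diag k d) (mat_diag k d) (0\<^sub>m k k)"
  have ent: "u i \<bullet> (L *\<^sub>v u j) = 0" "v i \<bullet> (L *\<^sub>v v j) = 0"
    "u i \<bullet> (L *\<^sub>v v j) = (if i = j then - d i else 0)"
    "v i \<bullet> (L *\<^sub>v u j) = (if i = j then d i else 0)" if "i < k" "j < k" for i j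
    using fam'(1,2)[OF that(1)] fam'(1,2)[OF that(2)] that
    by (simp_all add: Lu Lv scalar_prod_smult_distrib[of _ "2 * k"] uu uv vu vv)
  have SLS: "transpose_mat S * L * S = Lam"
    unfolding S_def Lam_def
    by (subst pair_mat_congruence[OF fam'(1,2) Lc])
       (auto simp: ent mat_diag_def intro!: cong_four_block_mat eq_matI)
  define Y where "Y = X * S"
  have Yc: "Y \<in> carrier_mat (2 * n) (2 * k)" using Xc Sc by (simp add: Y_def)
  have "transpose_mat Y * J_mat n * Y = transpose_mat S * (transpose_mat X * J_mat n * X) * S"
    using carrier_matD[OF Sc] by (simp add: Y_def)
  then have YSp: "Y \<in> Sp k n" using Yc SSp XJ by (simp add: Sp_def)
  \<comment> \<open>With \<open>Lam\<close> written as S^T L S, the inner product S S^T cancels and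
    the critical point equation for \<open>X\<close> applies.\<close>
  have "J_mat n * Y * Lam = J_mat n * X * (S * transpose_mat S) * L * S"
    using carrier_matD[OF Sc] by (simp add: Y_def flip: SLS)
  also have "\<dots> = M * X * S" unfolding MX OrSp_transpose(2)[OF SOr] by simp
  also have "\<dots> = M * Y" using carrier_matD[OF Sc] by (simp add: Y_def)
  finally have MY: "M * Y = J_mat n * Y * Lam" ..
  \<comment> \<open>The \<open>d i\<close> arose from \<open>A\<close>; the images of
    \<open>u i\<close> and \<open>v i\<close> under \<open>X\<close> satisfy the same pair of
    equations for \<open>M\<close>.\<close>
  have "symplectic_eigenvalue n M (d i)" if i: "i < k" for i
  proof (rule symplectic_eigenvalueI[OF M])
    show "X *\<^sub>v u i \<in> carrier_vec (2 * n)" "X *\<^sub>v v i \<in> carrier_vec (2 * n)"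
      using Xc fam' i by simp_all
    show "X *\<^sub>v u i \<noteq> 0\<^sub>v (2 * n)"
      using Sp_kernel[OF XSp fam'(1)[OF i]] uu[OF i i] by auto
    have MX': "M *\<^sub>v (X *\<^sub>v x) = J_mat n *\<^sub>v (X *\<^sub>v (L *\<^sub>v x))" if "x \<in> carrier_vec (2 * k)" for x
    proof -
      have "M *\<^sub>v (X *\<^sub>v x) = (M * X) *\<^sub>v x" using c that by simp
      then show ?thesis unfolding MX using c that by simp
    qed
    show "M *\<^sub>v (X *\<^sub>v u i) = d i \<cdot>\<^sub>v (J_mat n *\<^sub>v (X *\<^sub>v v i))"
      "M *\<^sub>v (X *\<^sub>v v i) = (- d i) \<cdot>\<^sub>v (J_mat n *\<^sub>v (X *\<^sub>v u i))"
      using fam'(1,2)[OF i] i Xc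
      by (simp_all add: MX' Lu Lv mult_mat_vec[OF Xc] mult_mat_vec[OF J_mat_carrier])
  qed (rule fam'(3)[OF i])
  then have "normalized_symplectic_eigenvector_set n k M Y"
    unfolding normalized_symplectic_eigenvector_set_def normalized_symplectic_eigenvector_set_for_def
    using YSp MY[unfolded Lam_def] by blast
  moreover have "X = Y * transpose_mat S"
    using Xc Sc ST by (simp add: Y_def OrSp_transpose(2)[OF SOr])
  ultimately show thesis using that OrSp_transpose(1)[OF SOr] YSp by blast
qed

theorem corollary4p4:
  fixes M :: "real mat" and n k :: nat
  assumes "sym_pos_def (2 * n) M"
    and "1 \<le> k" and "k \<le> n"
  shows "{X. critical_point n k M X} =
    (\<Union>X \<in> {X \<in> Sp k n. normalized_symplectic_eigenvector_set n k M X}. {X * K | K. K \<in> OrSp k})"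
proof -
  have Mc: "M \<in> carrier_mat (2 * n) (2 * n)" using assms(1) by (simp add: sym_pos_def_def)
  have "critical_point n k M X \<longleftrightarrow>
      (\<exists>Y K. K \<in> OrSp k \<and> Y \<in> Sp k n \<and> normalized_symplectic_eigenvector_set n k M Y \<and> X = Y * K)" for X
  proof
    assume "critical_point n k M X"
    then obtain Y K where "K \<in> OrSp k" "Y \<in> Sp k n"
      "normalized_symplectic_eigenvector_set n k M Y" "X = Y * K"
      by (rule critical_point_factorization[OF assms(1)])
    then show "\<exists>Y K. K \<in> OrSp k \<and> Y \<in> Sp k n \<and>
        normalized_symplectic_eigenvector_set n k M Y \<and> X = Y * K" by blast
  qed (use critical_point_mult_OrSp[OF Mc] in blast)
  then show ?thesis by blast
qed

end
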